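(* Let $x=x(s):I\to\mathbb{E}^3$ be a curve parametrized by arclength with nowhere vanishing Frenet curvatures $\kappa_1,\kappa_2$ and unit tangent $V_1$. Let $\overline{x}(s)=x(s)+(c-s)V_1(s)$, with $c$ a real constant, be an involute (of order $1$) of $x$, considered for $s\neq c$. Then the Frenet curvatures of $\overline{x}$ are $$\overline{\kappa}_1=\frac{\sqrt{\kappa_1^2+\kappa_2^2}}{|\kappa_1|\,|s-c|},\qquad \overline{\kappa}_2=\frac{\left(\frac{\kappa_2}{\kappa_1}\right)'\kappa_1}{(\kappa_1^2+\kappa_2^2)(c-s)}.$$
   Context: All curves are smooth. For a unit speed curve $x$ in $\mathbb{E}^3$ with right-handed orthonormal Frenet frame $V_1=x',V_2,V_3$, the Frenet curvatures $\kappa_1>0$ (curvature) and $\kappa_2\in\mathbb{R}$ (signed torsion) satisfy $V_1'=\kappa_1V_2$, $V_2'=-\kappa_1V_1+\kappa_2V_3$, $V_3'=-\kappa_2V_2$. For a regular curve $\overline{x}(s)$ with arbitrary parameter, its Frenet curvatures are $\overline{\kappa}_1=\|\overline{x}'\times\overline{x}''\|/\|\overline{x}'\|^3$ and $\overline{\kappa}_2=\langle\overline{x}'\times\overline{x}'',\overline{x}'''\rangle/\|\overline{x}'\times\overline{x}''\|^2$. An involute of order $1$ of $x$ is a curve $\overline{x}=x+\lambda_1V_1$ with $\lambda_1$ differentiable and $\langle\overline{x}',V_1\rangle=0$. Primes denote $d/ds$. *)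

theory Defs
  imports "HOL-Analysis.Analysis"
begin

(* Derivatives are taken within I, so they are one-sided at endpoints belonging to I, and
   depend only on the values of f on I. *)
definition deriv_on :: "real set \<Rightarrow> (real \<Rightarrow> 'a::real_normed_vector) \<Rightarrow> real \<Rightarrow> 'a" where
  "deriv_on I f = (\<lambda>s. vector_derivative f (at s within I))"

definition smooth_curve_on :: "real set \<Rightarrow> (real \<Rightarrow> 'a::real_normed_vector) \<Rightarrow> bool" where
  "smooth_curve_on I f \<longleftrightarrow>
     (\<forall>n. \<forall>s\<in>I. ((deriv_on I ^^ n) f) differentiable (at s within I))"

(* Since V1 is the derivative of x, norm (V1 s) = 1 also says that x has unit speed.
   The frame is right-handed because V3 = V1 x V2. *)
definition frenet_frame_on ::
  "real set \<Rightarrow> (real \<Rightarrow> real^3) \<Rightarrow> (real \<Rightarrow> real^3) \<Rightarrow> (real \<Rightarrow> real^3) \<Rightarrow> (real \<Rightarrow> real^3)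
    \<Rightarrow> (real \<Rightarrow> real) \<Rightarrow> (real \<Rightarrow> real) \<Rightarrow> bool" where
  "frenet_frame_on I x V1 V2 V3 \<kappa>1 \<kappa>2 \<longleftrightarrow>
     (\<forall>s\<in>I.
        norm (V1 s) = 1 \<and> norm (V2 s) = 1 \<and> norm (V3 s) = 1 \<and>
        V1 s \<bullet> V2 s = 0 \<and> V1 s \<bullet> V3 s = 0 \<and> V2 s \<bullet> V3 s = 0 \<and>
        V3 s = cross3 (V1 s) (V2 s) \<and>
        \<kappa>1 s > 0 \<and>
        (x has_vector_derivative V1 s) (at s within I) \<and>
        (V1 has_vector_derivative \<kappa>1 s *\<^sub>R V2 s) (at s within I) \<and>
        (V2 has_vector_derivative - \<kappa>1 s *\<^sub>R V1 s + \<kappa>2 s *\<^sub>R V3 s) (at s within I) \<and>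
        (V3 has_vector_derivative - \<kappa>2 s *\<^sub>R V2 s) (at s within I))"

definition frenet_curvature1 :: "real set \<Rightarrow> (real \<Rightarrow> real^3) \<Rightarrow> real \<Rightarrow> real" where
  "frenet_curvature1 I y s =
     norm (cross3 (deriv_on I y s) ((deriv_on I ^^ 2) y s)) / norm (deriv_on I y s) ^ 3"

definition frenet_curvature2 :: "real set \<Rightarrow> (real \<Rightarrow> real^3) \<Rightarrow> real \<Rightarrow> real" where
  "frenet_curvature2 I y s =
     (cross3 (deriv_on I y s) ((deriv_on I ^^ 2) y s) \<bullet> (deriv_on I ^^ 3) y s) /
     norm (cross3 (deriv_on I y s) ((deriv_on I ^^ 2) y s)) ^ 2"

definition involute_order1_on ::
  "real set \<Rightarrow> (real \<Rightarrow> real^3) \<Rightarrow> (real \<Rightarrow> real^3) \<Rightarrow> bool" where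
  "involute_order1_on I x y \<longleftrightarrow>
     (\<exists>l :: real \<Rightarrow> real. \<forall>s\<in>I.
        l differentiable (at s within I) \<and>
        y s = x s + l s *\<^sub>R deriv_on I x s \<and>
        deriv_on I y s \<bullet> deriv_on I x s = 0)"

end

(*
  Along the involute, xbar' = a V2 with a = (c - s) \<kappa>1, so the Frenet equations give xbar'' and xbar'''
  in the frame of x. Their combination xbar' \<times> xbar'' = a^2 (\<kappa>2 V1 + \<kappa>1 V3) is orthogonal to V2 and to
  V2', so neither a' nor a'' survives in either curvature. Differentiability of \<kappa>1, \<kappa>1' and \<kappa>2 is
  read off from the smoothness of x through \<kappa>1 = <x'', V2>, \<kappa>1' = <x''', V2>,
  \<kappa>1 \<kappa>2 = <x''', V3>.
*)
theory Submission
  imports Defs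
begin

section \<open>Derivatives within an interval and vector algebra\<close>

text \<open>An interval with nonempty interior is not a singleton, so each of its points, endpoints
  included, is a limit point and the derivative within \<open>I\<close> is unique. Agreement on
  \<open>I\<close> suffices, which lets a closed form valid on \<open>I\<close> be differentiated
  again.\<close>

lemma deriv_on_eqI:
  fixes f g :: "real \<Rightarrow> 'a::real_normed_vector"
  assumes "is_interval I" "interior I \<noteq> {}" "s \<in> I" "\<And>t. t \<in> I \<Longrightarrow> f t = g t"
    and "(g has_vector_derivative d) (at s within I)"
  shows "deriv_on I f s = d"
proof -
  have "\<nexists>a. I = {a}"
    using assms(2) by auto
  then have "s islimpt I"
    using connected_imp_perfect assms(1,3) is_interval_connected by blast
  then have "at s within I \<noteq> bot"
    by (simp add: trivial_limit_within)
  moreover have "(f has_vector_derivative d) (at s within I)"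
    using has_vector_derivative_transform[OF assms(3,4,5)] by simp
  ultimately show ?thesis
    unfolding deriv_on_def by (rule vector_derivative_within)
qed

lemma smooth_curve_on_has_vector_derivative:
  assumes "smooth_curve_on I f" "s \<in> I"
  shows "((deriv_on I ^^ n) f has_vector_derivative (deriv_on I ^^ Suc n) f s) (at s within I)"
  using assms vector_derivative_works[of "(deriv_on I ^^ n) f" "at s within I"]
  unfolding smooth_curve_on_def by (simp add: deriv_on_def)

lemma has_vector_derivative_inner:
  fixes f g :: "real \<Rightarrow> 'a::real_inner"
  assumes "(f has_vector_derivative f') (at s within I)" "(g has_vector_derivative g') (at s within I)"
  shows "((\<lambda>t. f t \<bullet> g t) has_vector_derivative f s \<bullet> g' + f' \<bullet> g s) (at s within I)"
  using bounded_bilinear.has_vector_derivative[OF bounded_bilinear_inner assms] by simp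

text \<open>The \<open>b\<close> term dies with v \<times> v = 0. It is applied with
  \<open>a\<close> the signed speed of the involute and \<open>b\<close> its derivative.\<close>

lemma cross3_frame_combination:
  fixes u v w :: "real^3"
  assumes "norm u = 1" "norm v = 1" "u \<bullet> v = 0" "w = cross3 u v"
  shows "cross3 (a *\<^sub>R v) (b *\<^sub>R v + a *\<^sub>R (- p *\<^sub>R u + q *\<^sub>R w)) = a\<^sup>2 *\<^sub>R (q *\<^sub>R u + p *\<^sub>R w)"
proof -
  have "v \<bullet> v = 1"
    using assms(2) by (simp add: norm_eq_1)
  \<comment> \<open>Lagrange's identity: v \<times> (u \<times> v) = <v,v> u - <v,u> v.\<close>
  then have "cross3 v w = u"
    using assms(3,4) by (simp add: Lagrange inner_commute)
  moreover have "cross3 v u = - w"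
    using assms(4) cross_skew by metis
  ultimately show ?thesis
    by (simp add: cross_add_right cross_mult_left cross_mult_right Cross3.right_diff_distrib
        power2_eq_square scaleR_add_right mult.commute mult.left_commute)
qed

section \<open>Curvature and torsion of the base curve as differentiable functions\<close>

context
  fixes I :: "real set" and x V1 V2 V3 :: "real \<Rightarrow> real^3" and \<kappa>1 \<kappa>2 :: "real \<Rightarrow> real"
  assumes I: "is_interval I" "interior I \<noteq> {}"
    and smooth: "smooth_curve_on I x"
    and frame: "frenet_frame_on I x V1 V2 V3 \<kappa>1 \<kappa>2"
begin

lemma frenet_frame_inner:
  assumes "s \<in> I"
  shows "V1 s \<bullet> V1 s = 1" "V2 s \<bullet> V2 s = 1" "V3 s \<bullet> V3 s = 1"
    "V1 s \<bullet> V2 s = 0" "V1 s \<bullet> V3 s = 0" "V2 s \<bullet> V3 s = 0"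
    "V2 s \<bullet> V1 s = 0" "V3 s \<bullet> V1 s = 0" "V3 s \<bullet> V2 s = 0"
  using frame assms unfolding frenet_frame_on_def by (auto simp: norm_eq_1 inner_commute)

lemma frenet_frame_deriv:
  assumes "s \<in> I"
  shows "\<kappa>1 s > 0"
    "(x has_vector_derivative V1 s) (at s within I)"
    "(V1 has_vector_derivative \<kappa>1 s *\<^sub>R V2 s) (at s within I)"
    "(V2 has_vector_derivative - \<kappa>1 s *\<^sub>R V1 s + \<kappa>2 s *\<^sub>R V3 s) (at s within I)"
    "(V3 has_vector_derivative - \<kappa>2 s *\<^sub>R V2 s) (at s within I)"
  using frame assms unfolding frenet_frame_on_def by auto

lemma deriv_on_curve2:
  assumes "s \<in> I"
  shows "(deriv_on I ^^ 2) x s = \<kappa>1 s *\<^sub>R V2 s"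
proof -
  have "deriv_on I x t = V1 t" if "t \<in> I" for t
    using deriv_on_eqI[OF I that] frenet_frame_deriv(2)[OF that] by blast
  then show ?thesis
    using deriv_on_eqI[OF I assms _ frenet_frame_deriv(3)[OF assms]] by (simp add: numeral_2_eq_2)
qed

text \<open>Differentiate \<kappa>1 = <x'', V2>: the term <x'', V2'> vanishes, since x'' is parallel
  to V2 and V2' is orthogonal to it. From here on <x''', V2> serves as the name of
  \<kappa>1'.\<close>

lemma curvature_has_vector_derivative:
  assumes "s \<in> I"
  shows "(\<kappa>1 has_vector_derivative (deriv_on I ^^ 3) x s \<bullet> V2 s) (at s within I)"
proof (rule has_vector_derivative_transform[OF assms])
  have "((deriv_on I ^^ 2) x has_vector_derivative (deriv_on I ^^ 3) x s) (at s within I)"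
    using smooth_curve_on_has_vector_derivative[OF smooth assms, of 2] by (simp add: numeral_eq_Suc)
  from has_vector_derivative_inner[OF this frenet_frame_deriv(4)[OF assms]]
  show "((\<lambda>t. (deriv_on I ^^ 2) x t \<bullet> V2 t) has_vector_derivative (deriv_on I ^^ 3) x s \<bullet> V2 s)
      (at s within I)"
    using assms by (simp add: deriv_on_curve2 inner_add_right inner_diff_right frenet_frame_inner)
  show "\<kappa>1 t = (deriv_on I ^^ 2) x t \<bullet> V2 t" if "t \<in> I" for t
    using that by (simp add: deriv_on_curve2 frenet_frame_inner)
qed

text \<open>Product rule on x'' = \<kappa>1 V2. The purpose is the V3-component \<kappa>1 \<kappa>2,
  which gives access to the torsion.\<close>

lemma deriv_on_curve3:
  assumes "s \<in> I"
  shows "(deriv_on I ^^ 3) x s =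
    \<kappa>1 s *\<^sub>R (- \<kappa>1 s *\<^sub>R V1 s + \<kappa>2 s *\<^sub>R V3 s) + ((deriv_on I ^^ 3) x s \<bullet> V2 s) *\<^sub>R V2 s"
proof -
  have "deriv_on I ((deriv_on I ^^ 2) x) s =
      \<kappa>1 s *\<^sub>R (- \<kappa>1 s *\<^sub>R V1 s + \<kappa>2 s *\<^sub>R V3 s) + ((deriv_on I ^^ 3) x s \<bullet> V2 s) *\<^sub>R V2 s"
    by (rule deriv_on_eqI[OF I assms deriv_on_curve2])
      (use bounded_bilinear.has_vector_derivative[OF bounded_bilinear_scaleR
        curvature_has_vector_derivative[OF assms] frenet_frame_deriv(4)[OF assms]] in auto)
  then show ?thesis
    by (simp add: numeral_eq_Suc)
qed

text \<open>Existence of \<kappa>1'' is enough: it enters the third derivative of the involute only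
  as part of a coefficient of V2, which the final inner product kills.\<close>

lemma curvature_deriv_has_vector_derivative:
  assumes "s \<in> I"
  obtains d where
    "((\<lambda>t. (deriv_on I ^^ 3) x t \<bullet> V2 t) has_vector_derivative d) (at s within I)"
  using has_vector_derivative_inner[OF smooth_curve_on_has_vector_derivative[OF smooth assms]
      frenet_frame_deriv(4)[OF assms]] by blast

text \<open>Since \<kappa>1 > 0, the torsion is the quotient of <x''', V3> by \<kappa>1, and both
  are differentiable.\<close>

lemma torsion_has_vector_derivative:
  assumes "s \<in> I"
  obtains d where "(\<kappa>2 has_vector_derivative d) (at s within I)"
proof -
  obtain e where
    "((\<lambda>t. (deriv_on I ^^ 3) x t \<bullet> V3 t) has_vector_derivative e) (at s within I)"
    using has_vector_derivative_inner[OF smooth_curve_on_has_vector_derivative[OF smooth assms]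
        frenet_frame_deriv(5)[OF assms]] by blast
  then have quot: "((\<lambda>t. ((deriv_on I ^^ 3) x t \<bullet> V3 t) / \<kappa>1 t) has_vector_derivative
      (e * \<kappa>1 s - ((deriv_on I ^^ 3) x s \<bullet> V3 s) * ((deriv_on I ^^ 3) x s \<bullet> V2 s)) / (\<kappa>1 s * \<kappa>1 s))
      (at s within I)"
    using curvature_has_vector_derivative[OF assms] frenet_frame_deriv(1)[OF assms]
    unfolding has_real_derivative_iff_has_vector_derivative[symmetric]
    by (intro DERIV_divide) auto
  have "\<kappa>2 t = ((deriv_on I ^^ 3) x t \<bullet> V3 t) / \<kappa>1 t" if "t \<in> I" for t
    using frenet_frame_deriv(1)[OF that]
    \<comment> \<open>A single rewrite, because x''' recurs on the right-hand side; that occurrence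
      multiplies <V2, V3> = 0.\<close>
    by (subst deriv_on_curve3[OF that])
      (simp add: inner_add_left inner_diff_left frenet_frame_inner[OF that])
  then show thesis
    by (rule that[OF has_vector_derivative_transform[OF assms _ quot]])
qed

section \<open>The involute and its first three derivatives\<close>

context
  fixes xbar :: "real \<Rightarrow> real^3" and c :: real
  assumes xbar: "\<And>s. s \<in> I \<Longrightarrow> xbar s = x s + (c - s) *\<^sub>R V1 s"
begin

text \<open>The V1 coming from x' cancels against the derivative -1 of the factor c - s.\<close>

lemma deriv_on_involute:
  assumes "s \<in> I"
  shows "deriv_on I xbar s = ((c - s) * \<kappa>1 s) *\<^sub>R V2 s"
proof (rule deriv_on_eqI[OF I assms xbar])
  have "((\<lambda>t. c - t) has_vector_derivative - 1) (at s within I)"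
    by (auto intro!: derivative_eq_intros)
  from has_vector_derivative_add[OF frenet_frame_deriv(2)[OF assms]
      bounded_bilinear.has_vector_derivative[OF bounded_bilinear_scaleR this frenet_frame_deriv(3)[OF assms]]]
  show "((\<lambda>t. x t + (c - t) *\<^sub>R V1 t) has_vector_derivative ((c - s) * \<kappa>1 s) *\<^sub>R V2 s)
      (at s within I)"
    by simp
qed

lemma involute_speed_has_vector_derivative:
  assumes "s \<in> I"
  shows "((\<lambda>t. (c - t) * \<kappa>1 t) has_vector_derivative
    (c - s) * ((deriv_on I ^^ 3) x s \<bullet> V2 s) - \<kappa>1 s) (at s within I)"
  using curvature_has_vector_derivative[OF assms]
  unfolding has_real_derivative_iff_has_vector_derivative[symmetric]
  by (auto intro!: derivative_eq_intros)

lemma deriv_on_involute2: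
  assumes "s \<in> I"
  shows "(deriv_on I ^^ 2) xbar s =
    ((c - s) * ((deriv_on I ^^ 3) x s \<bullet> V2 s) - \<kappa>1 s) *\<^sub>R V2 s +
    ((c - s) * \<kappa>1 s) *\<^sub>R (- \<kappa>1 s *\<^sub>R V1 s + \<kappa>2 s *\<^sub>R V3 s)"
proof -
  have "deriv_on I (deriv_on I xbar) s =
    ((c - s) * ((deriv_on I ^^ 3) x s \<bullet> V2 s) - \<kappa>1 s) *\<^sub>R V2 s +
    ((c - s) * \<kappa>1 s) *\<^sub>R (- \<kappa>1 s *\<^sub>R V1 s + \<kappa>2 s *\<^sub>R V3 s)"
    by (rule deriv_on_eqI[OF I assms deriv_on_involute])
      (use bounded_bilinear.has_vector_derivative[OF bounded_bilinear_scaleR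
        involute_speed_has_vector_derivative[OF assms] frenet_frame_deriv(4)[OF assms]]
        in \<open>auto simp: add.commute\<close>)
  then show ?thesis
    by (simp add: numeral_2_eq_2)
qed

lemma cross3_involute:
  assumes "s \<in> I"
  shows "cross3 (deriv_on I xbar s) ((deriv_on I ^^ 2) xbar s) =
    ((c - s) * \<kappa>1 s)\<^sup>2 *\<^sub>R (\<kappa>2 s *\<^sub>R V1 s + \<kappa>1 s *\<^sub>R V3 s)"
  unfolding deriv_on_involute[OF assms] deriv_on_involute2[OF assms]
  using frame assms unfolding frenet_frame_on_def
  by (intro cross3_frame_combination) auto

lemma norm_cross3_involute:
  assumes "s \<in> I"
  shows "norm (cross3 (deriv_on I xbar s) ((deriv_on I ^^ 2) xbar s)) =
    ((c - s) * \<kappa>1 s)\<^sup>2 * sqrt ((\<kappa>1 s)\<^sup>2 + (\<kappa>2 s)\<^sup>2)"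
proof -
  have "norm (\<kappa>2 s *\<^sub>R V1 s + \<kappa>1 s *\<^sub>R V3 s) = sqrt ((\<kappa>1 s)\<^sup>2 + (\<kappa>2 s)\<^sup>2)"
    unfolding norm_eq_sqrt_inner
    by (simp add: inner_add_left inner_add_right frenet_frame_inner[OF assms] power2_eq_square)
  then show ?thesis
    by (simp add: cross3_involute[OF assms])
qed

text \<open>With N = V2', the third derivative is a'' V2 + 2 a' N + a N'. The Darboux vector
  \<kappa>2 V1 + \<kappa>1 V3 is orthogonal to V2 and to N, so only a N' contributes, through its
  components -\<kappa>1' along V1 and \<kappa>2' along V3.\<close>

lemma deriv_on_involute3_inner:
  assumes "s \<in> I"
    and \<kappa>2': "(\<kappa>2 has_vector_derivative \<kappa>2') (at s within I)"
  shows "(\<kappa>2 s *\<^sub>R V1 s + \<kappa>1 s *\<^sub>R V3 s) \<bullet> (deriv_on I ^^ 3) xbar s =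
    (c - s) * \<kappa>1 s * (\<kappa>1 s * \<kappa>2' - \<kappa>2 s * ((deriv_on I ^^ 3) x s \<bullet> V2 s))"
proof -
  define k' where "k' = (\<lambda>t. (deriv_on I ^^ 3) x t \<bullet> V2 t)"
  define a where "a = (\<lambda>t. (c - t) * \<kappa>1 t)"
  define a' where "a' = (\<lambda>t. (c - t) * k' t - \<kappa>1 t)"
  define N where "N = (\<lambda>t. - \<kappa>1 t *\<^sub>R V1 t + \<kappa>2 t *\<^sub>R V3 t)"
  \<comment> \<open>Kept in the unsimplified shape that the product rule produces.\<close>
  define N' where "N' = (- \<kappa>1 s *\<^sub>R \<kappa>1 s *\<^sub>R V2 s + - k' s *\<^sub>R V1 s) +
    (\<kappa>2 s *\<^sub>R - \<kappa>2 s *\<^sub>R V2 s + \<kappa>2' *\<^sub>R V3 s)"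
  note scaleR_deriv = bounded_bilinear.has_vector_derivative[OF bounded_bilinear_scaleR]
  obtain k'' where "(k' has_vector_derivative k'') (at s within I)"
    using curvature_deriv_has_vector_derivative[OF assms(1)] unfolding k'_def by blast
  moreover have k': "(\<kappa>1 has_vector_derivative k' s) (at s within I)"
    using curvature_has_vector_derivative[OF assms(1)] unfolding k'_def .
  ultimately have "(a' has_vector_derivative (c - s) * k'' - k' s - k' s) (at s within I)"
    unfolding a'_def has_real_derivative_iff_has_vector_derivative[symmetric]
    by (auto intro!: derivative_eq_intros)
  \<comment> \<open>The value of \<open>a''\<close> can be forgotten: it multiplies V2.\<close>
  then obtain a'' where a'': "(a' has_vector_derivative a'') (at s within I)"
    by blast
  have a': "(a has_vector_derivative a' s) (at s within I)"
    using involute_speed_has_vector_derivative[OF assms(1)] unfolding a_def a'_def k'_def .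
  have N': "(N has_vector_derivative N') (at s within I)"
    unfolding N_def N'_def
    by (intro has_vector_derivative_add scaleR_deriv has_vector_derivative_minus k' \<kappa>2'
        frenet_frame_deriv assms(1))
  have "deriv_on I ((deriv_on I ^^ 2) xbar) s =
      (a' s *\<^sub>R N s + a'' *\<^sub>R V2 s) + (a s *\<^sub>R N' + a' s *\<^sub>R N s)"
  proof (rule deriv_on_eqI[OF I assms(1)])
    show "(deriv_on I ^^ 2) xbar t = a' t *\<^sub>R V2 t + a t *\<^sub>R N t" if "t \<in> I" for t
      using deriv_on_involute2[OF that] by (simp add: a_def a'_def k'_def N_def)
    show "((\<lambda>t. a' t *\<^sub>R V2 t + a t *\<^sub>R N t) has_vector_derivative
        (a' s *\<^sub>R N s + a'' *\<^sub>R V2 s) + (a s *\<^sub>R N' + a' s *\<^sub>R N s)) (at s within I)"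
      by (intro has_vector_derivative_add scaleR_deriv a'' a' N')
        (use frenet_frame_deriv(4)[OF assms(1)] in \<open>simp add: N_def\<close>)
  qed
  then have "(deriv_on I ^^ 3) xbar s =
      (a' s *\<^sub>R N s + a'' *\<^sub>R V2 s) + (a s *\<^sub>R N' + a' s *\<^sub>R N s)"
    by (simp add: numeral_eq_Suc)
  then have "(\<kappa>2 s *\<^sub>R V1 s + \<kappa>1 s *\<^sub>R V3 s) \<bullet> (deriv_on I ^^ 3) xbar s =
      a s * (\<kappa>1 s * \<kappa>2' - \<kappa>2 s * k' s)"
    unfolding N_def N'_def
    by (simp only: inner_simps frenet_frame_inner[OF assms(1)]) (simp add: algebra_simps)
  then show ?thesis
    by (simp add: a_def k'_def)
qed

section \<open>The Frenet curvatures of the involute\<close>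

text \<open>With a = (c - s) \<kappa>1, the factor \<open>a^2\<close> of the cross product over the
  cubed speed \<open>|a|^3\<close> leaves 1/|a|.\<close>

lemma involute_frenet_curvature1:
  assumes "s \<in> I" "s \<noteq> c"
  shows "frenet_curvature1 I xbar s = sqrt ((\<kappa>1 s)\<^sup>2 + (\<kappa>2 s)\<^sup>2) / (\<bar>\<kappa>1 s\<bar> * \<bar>s - c\<bar>)"
proof -
  define a where "a = (c - s) * \<kappa>1 s"
  have "a \<noteq> 0"
    using assms frenet_frame_deriv(1)[OF assms(1)] by (simp add: a_def)
  moreover have "norm (deriv_on I xbar s) = \<bar>a\<bar>"
    using frame assms(1) by (simp add: deriv_on_involute a_def frenet_frame_on_def)
  moreover have "\<bar>\<kappa>1 s\<bar> * \<bar>s - c\<bar> = \<bar>a\<bar>"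
    by (simp add: a_def abs_mult abs_minus_commute)
  moreover have "a\<^sup>2 = \<bar>a\<bar>\<^sup>2"
    by simp
  ultimately show ?thesis
    unfolding frenet_curvature1_def norm_cross3_involute[OF assms(1)] a_def[symmetric]
    by (simp add: power2_eq_square power3_eq_cube divide_simps)
qed

text \<open>Here the powers of \<open>a\<close> reduce as \<open>a^3 / a^4\<close> = 1/a, so the
  sign of c - s survives, unlike in the first curvature.\<close>

lemma involute_frenet_curvature2:
  assumes "s \<in> I" "s \<noteq> c"
  shows "frenet_curvature2 I xbar s =
    (deriv_on I (\<lambda>t. \<kappa>2 t / \<kappa>1 t) s * \<kappa>1 s) / (((\<kappa>1 s)\<^sup>2 + (\<kappa>2 s)\<^sup>2) * (c - s))"
proof -
  define k' where "k' = (deriv_on I ^^ 3) x s \<bullet> V2 s"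
  define a where "a = (c - s) * \<kappa>1 s"
  define S where "S = (\<kappa>1 s)\<^sup>2 + (\<kappa>2 s)\<^sup>2"
  obtain \<kappa>2' where \<kappa>2': "(\<kappa>2 has_vector_derivative \<kappa>2') (at s within I)"
    using torsion_has_vector_derivative[OF assms(1)] .
  have pos: "\<kappa>1 s > 0"
    using frenet_frame_deriv(1)[OF assms(1)] .
  then have "((\<lambda>t. \<kappa>2 t / \<kappa>1 t) has_vector_derivative (\<kappa>2' * \<kappa>1 s - \<kappa>2 s * k') / (\<kappa>1 s * \<kappa>1 s))
      (at s within I)"
    using \<kappa>2' curvature_has_vector_derivative[OF assms(1)]
    unfolding has_real_derivative_iff_has_vector_derivative[symmetric] k'_def
    by (intro DERIV_divide) auto
  then have quot: "deriv_on I (\<lambda>t. \<kappa>2 t / \<kappa>1 t) s = (\<kappa>2' * \<kappa>1 s - \<kappa>2 s * k') / (\<kappa>1 s * \<kappa>1 s)"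
    using deriv_on_eqI[OF I assms(1)] by blast
  have "S > 0"
    using pos by (simp add: S_def add_pos_nonneg)
  have "frenet_curvature2 I xbar s = a\<^sup>2 * (a * (\<kappa>1 s * \<kappa>2' - \<kappa>2 s * k')) / (a\<^sup>2 * sqrt S)\<^sup>2"
    unfolding frenet_curvature2_def norm_cross3_involute[OF assms(1)]
    using deriv_on_involute3_inner[OF assms(1) \<kappa>2']
    by (simp add: cross3_involute[OF assms(1)] a_def k'_def S_def)
  also have "\<dots> = a\<^sup>2 * (a * (\<kappa>1 s * \<kappa>2' - \<kappa>2 s * k')) / (a\<^sup>2 * a\<^sup>2 * S)"
    using \<open>S > 0\<close> by (simp add: power_mult_distrib power2_eq_square)
  also have "\<dots> = (\<kappa>1 s * \<kappa>2' - \<kappa>2 s * k') / (a * S)"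
    using pos assms(2) by (simp add: a_def power2_eq_square)
  \<comment> \<open>The quotient rule reads \<kappa>1 \<kappa>2' - \<kappa>2 \<kappa>1' =
    \<open>\<kappa>1^2\<close> (\<kappa>2/\<kappa>1)'; one factor \<kappa>1 cancels against the one
    in \<open>a\<close>.\<close>
  also have "\<dots> = deriv_on I (\<lambda>t. \<kappa>2 t / \<kappa>1 t) s * \<kappa>1 s / (S * (c - s))"
    using pos by (simp add: quot a_def mult.commute mult.left_commute)
  finally show ?thesis
    by (simp add: S_def)
qed

end

end

theorem proposition2:
  fixes I :: "real set" and x xbar V1 V2 V3 :: "real \<Rightarrow> real^3"
    and \<kappa>1 \<kappa>2 :: "real \<Rightarrow> real" and c :: real
  assumes "is_interval I" and "interior I \<noteq> {}"
    and "smooth_curve_on I x"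
    and "frenet_frame_on I x V1 V2 V3 \<kappa>1 \<kappa>2"
    and "\<And>s. s \<in> I \<Longrightarrow> \<kappa>1 s \<noteq> 0"
    and "\<And>s. s \<in> I \<Longrightarrow> \<kappa>2 s \<noteq> 0"
    and "\<And>s. s \<in> I \<Longrightarrow> xbar s = x s + (c - s) *\<^sub>R V1 s"
    and "involute_order1_on I x xbar"
  shows "\<forall>s \<in> I - {c}.
      frenet_curvature1 I xbar s = sqrt ((\<kappa>1 s)\<^sup>2 + (\<kappa>2 s)\<^sup>2) / (\<bar>\<kappa>1 s\<bar> * \<bar>s - c\<bar>) \<and>
      frenet_curvature2 I xbar s =
        (deriv_on I (\<lambda>t. \<kappa>2 t / \<kappa>1 t) s * \<kappa>1 s) / (((\<kappa>1 s)\<^sup>2 + (\<kappa>2 s)\<^sup>2) * (c - s))"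
  by (intro ballI conjI involute_frenet_curvature1[OF assms(1-4,7)]
      involute_frenet_curvature2[OF assms(1-4,7)]) auto

end
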